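(* Let $K_n$ be the complete graph on $n\geq 1$ vertices. For the number $d_{coe}(K_n,i)$ of co-even dominating sets of $K_n$ with cardinality $i$, where $0<i\leq n$: (i) If $n$ is even, then $d_{coe}(K_n,i)=0$ for $i<n$, and $d_{coe}(K_n,n)=1$. (ii) If $n$ is odd, then $d_{coe}(K_n,i)=\binom{n}{i}$.
   Context: For a finite simple graph $G=(V,E)$, a set $D\subseteq V$ is a dominating set if every vertex of $V-D$ is adjacent to at least one vertex of $D$; a dominating set $D$ is a co-even dominating set if the degree in $G$ of every vertex of $V-D$ is even. $d_{coe}(G,i)$ denotes the number of co-even dominating sets of $G$ of cardinality $i$. *)

theory Defs
  imports "Graph_Theory.Kuratowski"
begin

text \<open>
  Finite simple graphs are the library's \<^locale>\<open>graph\<close>: finite, loop-free, symmetric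
  digraphs without parallel arcs. Each edge is thus a pair of opposite arcs, adjacency is
  \<^const>\<open>dominates\<close>, and \<open>K\<^bsub>n\<^esub> G\<close> says that \<open>G\<close> is such a graph,
  complete on \<open>n\<close> vertices.
\<close>

definition dominating_set :: "('a, 'b) pre_digraph \<Rightarrow> 'a set \<Rightarrow> bool" where
  "dominating_set G D \<longleftrightarrow>
     D \<subseteq> verts G \<and> (\<forall>v \<in> verts G - D. \<exists>u \<in> D. v \<rightarrow>\<^bsub>G\<^esub> u)"

text \<open>
  In a \<^locale>\<open>graph\<close> every edge at \<open>v\<close> contributes exactly one arc leaving \<open>v\<close>, so
  the degree of \<open>v\<close> is its out-degree (not the sum of in- and out-degree).
\<close>

definition co_even_dominating_set :: "('a, 'b) pre_digraph \<Rightarrow> 'a set \<Rightarrow> bool" where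
  "co_even_dominating_set G D \<longleftrightarrow>
     dominating_set G D \<and> (\<forall>v \<in> verts G - D. even (out_degree G v))"

definition d_coe :: "('a, 'b) pre_digraph \<Rightarrow> nat \<Rightarrow> nat" where
  "d_coe G i = card {D. co_even_dominating_set G D \<and> card D = i}"

end

theory Submission
  imports Defs
begin

text \<open>In a complete graph any nonempty vertex set dominates, and every vertex has degree n -
  1, so only parity matters. For odd n all degrees are even, and the nonempty sets of vertices are
  exactly the nonempty co-even dominating sets. For even n all degrees are odd, so no vertex may
  stay outside and only the full vertex set qualifies. This dichotomy is
  \<open>co_even_dominating_set_complete_digraph_iff\<close>; the rest is counting.\<close>

lemma out_degree_complete_digraph:
  assumes "complete_digraph n G" and "v \<in> verts G"
  shows "out_degree G v = n - 1"
proof -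
  interpret graph G using assms(1) by (simp add: complete_digraph_def)
  \<comment> \<open>Arcs leaving \<open>v\<close> share their tail, so without parallel arcs the
    head determines the arc, and the out-degree counts neighbours.\<close>
  have inj: "inj_on (head G) (out_arcs G v)"
    by (rule inj_onI) (auto intro: no_multi_arcs simp: arc_to_ends_def)
  have "head G ` out_arcs G v = {w. v \<rightarrow>\<^bsub>G\<^esub> w}"
    by (force simp: out_arcs_def arcs_ends_def arc_to_ends_def)
  also have "\<dots> = verts G - {v}"
    using assms by (auto simp: complete_digraph_def)
  finally have "card (verts G - {v}) = out_degree G v"
    using inj by (metis card_image out_degree_def)
  then show ?thesis
    using assms by (simp add: complete_digraph_def)
qed

text \<open>Any single element of \<open>D\<close> is adjacent to every vertex outside
  \<open>D\<close>.\<close>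

lemma dominating_set_complete_digraph_iff:
  assumes "complete_digraph n G" and "D \<noteq> {}"
  shows "dominating_set G D \<longleftrightarrow> D \<subseteq> verts G"
  using assms by (fastforce simp: dominating_set_def complete_digraph_def)

lemma co_even_dominating_set_complete_digraph_iff:
  assumes "complete_digraph n G" and "D \<noteq> {}"
  shows "co_even_dominating_set G D \<longleftrightarrow>
    D \<subseteq> verts G \<and> (even n \<longrightarrow> D = verts G)"
proof -
  interpret graph G using assms(1) by (simp add: complete_digraph_def)
  \<comment> \<open>Subtraction is truncated: the equivalence fails at \<open>n = 0\<close>, which
    the existence of a vertex rules out.\<close>
  have "odd (n - 1) \<longleftrightarrow> even n" if "v \<in> verts G" for v
  proof -
    have "n > 0"
      using that assms(1) finite_verts by (auto simp: complete_digraph_def card_gt_0_iff)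
    then show ?thesis by simp
  qed
  then show ?thesis
    unfolding co_even_dominating_set_def dominating_set_complete_digraph_iff[OF assms]
    using out_degree_complete_digraph[OF assms(1)] by auto
qed

theorem proposition4p7:
  fixes G :: "('a, 'b) pre_digraph" and n :: nat
  assumes "n \<ge> 1"
    and "complete_digraph n G"
  shows "(even n \<longrightarrow> (\<forall>i. 0 < i \<and> i < n \<longrightarrow> d_coe G i = 0) \<and> d_coe G n = 1)
       \<and> (odd n \<longrightarrow> (\<forall>i. 0 < i \<and> i \<le> n \<longrightarrow> d_coe G i = n choose i))"
proof -
  interpret graph G using assms(2) by (simp add: complete_digraph_def)
  have card: "card (verts G) = n"
    using assms(2) by (simp add: complete_digraph_def)
  have d_coe: "d_coe G i =
      card {D. D \<subseteq> verts G \<and> (even n \<longrightarrow> D = verts G) \<and> card D = i}" if "0 < i" for i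
  proof -
    have "co_even_dominating_set G D \<and> card D = i \<longleftrightarrow>
        D \<subseteq> verts G \<and> (even n \<longrightarrow> D = verts G) \<and> card D = i" for D
      \<comment> \<open>The empty set has cardinality 0, so with \<open>0 < i\<close> it satisfies
        neither side.\<close>
      using co_even_dominating_set_complete_digraph_iff[OF assms(2), of D] that by (cases "D = {}") auto
    then show ?thesis by (simp add: d_coe_def)
  qed
  have "d_coe G i = 0" if "even n" "0 < i" "i < n" for i
    using that card by (auto simp: d_coe)
  moreover have "d_coe G n = 1" if "even n"
  proof -
    have "{D. D \<subseteq> verts G \<and> (even n \<longrightarrow> D = verts G) \<and> card D = n} = {verts G}"
      using that card by auto
    then show ?thesis using d_coe[of n] assms(1) by simp
  qed
  \<comment> \<open>For odd \<open>n\<close> the parity clause is vacuous, leaving all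
    \<open>i\<close>-element sets of vertices.\<close>
  moreover have "d_coe G i = n choose i" if "odd n" "0 < i" for i
    using that n_subsets[OF finite_verts, of i] by (simp add: d_coe card)
  ultimately show ?thesis by blast
qed

end
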